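(* Assume that for every $x\in\mathcal X$ the function $f(x,\cdot)$ is concave on $\mathcal Y$ (no convexity of $f(\cdot,y)$ is assumed) and that $f$ satisfies the Lipschitz gradient assumption with constants $L_{11},L_{12},L_{21},L_{22}>0$. Let $\{c_k\}_{k\ge1}$ be a positive monotonically decreasing sequence, let $\bar\eta,\bar\rho>0$ be constants, $\{\bar\beta_k\}_{k\ge1}$ real numbers, and let $\{(x_k,y_k)\}_{k\ge1}$ be generated from $(x_1,y_1)\in\mathcal X\times\mathcal Y$ by $$x_{k+1}=\mathcal P_{\mathcal X}\Big(x_k-\tfrac1{\bar\eta+\bar\beta_k}\nabla_xf(x_k,y_k)\Big),\qquad y_{k+1}=\mathcal P_{\mathcal Y}\big(y_k+\bar\rho\nabla_yf(x_{k+1},y_k)-\bar\rho c_ky_k\big),\quad k\ge1.$$ Put $L_{22}'=L_{22}+c_1$ and, for $k\ge1$, $$\mathcal S_{k+1}=\frac8{\bar\rho^2c_{k+1}}\|y_{k+1}-y_k\|^2+\frac8{\bar\rho}\Big(1-\frac{c_k}{c_{k+1}}\Big)\|y_{k+1}\|^2,$$ $$\mathcal F_{k+1}=f(x_{k+1},y_{k+1})+\mathcal S_{k+1}-\frac{15}{2\bar\rho}\|y_{k+1}-y_k\|^2-\frac{c_k}{2}\|y_{k+1}\|^2 .$$ If for all $k$ $$\bar\beta_k>L_{11},\qquad \frac1{c_{k+1}}-\frac1{c_k}\le\frac{\bar\rho}{5},\qquad \bar\rho\le\frac2{L_{22}'+c_1},$$ then for all $k\ge2$, $$\mathcal F_{k+1}-\mathcal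 F_k\le-\Big(\bar\eta+\frac{\bar\beta_k}{2}-\frac{\bar\rho L_{12}^2}{2}-\frac{16L_{12}^2}{\bar\rho c_k^2}\Big)\|x_{k+1}-x_k\|^2+\frac{c_{k-1}-c_k}{2}\|y_{k+1}\|^2-\frac9{10\bar\rho}\|y_{k+1}-y_k\|^2+\frac8{\bar\rho}\Big(\frac{c_{k-1}}{c_k}-\frac{c_k}{c_{k+1}}\Big)\|y_{k+1}\|^2 .$$
   Context: $\mathcal X\subseteq\mathbb R^n$ and $\mathcal Y\subseteq\mathbb R^m$ are nonempty closed bounded convex sets and $f:\mathcal X\times\mathcal Y\to\mathbb R$ is a smooth function. $\|\cdot\|$ is the Euclidean norm; $\mathcal P_{\mathcal X},\mathcal P_{\mathcal Y}$ are Euclidean projections. Lipschitz gradient assumption: for all $x,\bar x\in\mathcal X$, $y,\bar y\in\mathcal Y$: $\|\nabla_xf(x,y)-\nabla_xf(\bar x,y)\|\le L_{11}\|x-\bar x\|$, $\|\nabla_xf(x,y)-\nabla_xf(x,\bar y)\|\le L_{21}\|y-\bar y\|$, $\|\nabla_yf(x,y)-\nabla_yf(x,\bar y)\|\le L_{22}\|y-\bar y\|$, $\|\nabla_yf(x,y)-\nabla_yf(\bar x,y)\|\le L_{12}\|x-\bar x\|$. *)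

theory Defs
  imports "HOL-Analysis.Analysis"
begin

text \<open>
  The objective is only given on \<open>X \<times> Y\<close>, so smoothness is continuous differentiability
  there, with derivatives taken within \<open>X \<times> Y\<close> (one-sided at boundary points); only values
  of \<open>f\<close> on \<open>X \<times> Y\<close> matter. The maps \<open>gx\<close> and \<open>gy\<close> play the roles of
  \<open>\<nabla>\<^sub>x f\<close> and \<open>\<nabla>\<^sub>y f\<close>. They are the two components of the ordinary gradient whenever
  \<open>f\<close> is continuously differentiable near \<open>X \<times> Y\<close>, and they are determined by \<open>f\<close> on
  \<open>X \<times> Y\<close> when \<open>X\<close> and \<open>Y\<close> are convex with nonempty interior. Otherwise a
  gradient within \<open>X \<times> Y\<close> is unique only up to normal components, and any
  choice is admitted.
\<close>

definition smooth_with_gradients ::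
  "'a::euclidean_space set \<Rightarrow> 'b::euclidean_space set \<Rightarrow> ('a \<Rightarrow> 'b \<Rightarrow> real) \<Rightarrow>
    ('a \<Rightarrow> 'b \<Rightarrow> 'a) \<Rightarrow> ('a \<Rightarrow> 'b \<Rightarrow> 'b) \<Rightarrow> bool"
  where "smooth_with_gradients X Y f gx gy \<longleftrightarrow>
    (\<forall>x\<in>X. \<forall>y\<in>Y. ((\<lambda>(u, v). f u v) has_derivative (\<lambda>(h, k). gx x y \<bullet> h + gy x y \<bullet> k))
       (at (x, y) within X \<times> Y)) \<and>
    continuous_on (X \<times> Y) (\<lambda>(x, y). gx x y) \<and>
    continuous_on (X \<times> Y) (\<lambda>(x, y). gy x y)"

definition lipschitz_gradients ::
  "'a::euclidean_space set \<Rightarrow> 'b::euclidean_space set \<Rightarrow> ('a \<Rightarrow> 'b \<Rightarrow> 'a) \<Rightarrow> ('a \<Rightarrow> 'b \<Rightarrow> 'b) \<Rightarrow>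
    real \<Rightarrow> real \<Rightarrow> real \<Rightarrow> real \<Rightarrow> bool"
  where "lipschitz_gradients X Y gx gy L11 L12 L21 L22 \<longleftrightarrow>
    (\<forall>x\<in>X. \<forall>x'\<in>X. \<forall>y\<in>Y. \<forall>y'\<in>Y.
       norm (gx x y - gx x' y) \<le> L11 * norm (x - x') \<and>
       norm (gx x y - gx x y') \<le> L21 * norm (y - y') \<and>
       norm (gy x y - gy x y') \<le> L22 * norm (y - y') \<and>
       norm (gy x y - gy x' y) \<le> L12 * norm (x - x'))"

text \<open>
  The usual definitions of \<open>S\<^sub>k\<^sub>+\<^sub>1\<close> and \<open>F\<^sub>k\<^sub>+\<^sub>1\<close>, for \<open>k \<ge> 1\<close>, are those below at \<open>j = k + 1\<close>.
  They are meaningful only for \<open>j \<ge> 2\<close>, where the truncated subtraction is harmless.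
\<close>

definition S_term :: "real \<Rightarrow> (nat \<Rightarrow> real) \<Rightarrow> (nat \<Rightarrow> 'b::euclidean_space) \<Rightarrow> nat \<Rightarrow> real"
  where "S_term \<rho> c y j =
    8 / (\<rho>\<^sup>2 * c j) * (norm (y j - y (j - 1)))\<^sup>2 +
    8 / \<rho> * (1 - c (j - 1) / c j) * (norm (y j))\<^sup>2"

definition F_potential ::
  "('a::euclidean_space \<Rightarrow> 'b::euclidean_space \<Rightarrow> real) \<Rightarrow> real \<Rightarrow> (nat \<Rightarrow> real) \<Rightarrow>
    (nat \<Rightarrow> 'a) \<Rightarrow> (nat \<Rightarrow> 'b) \<Rightarrow> nat \<Rightarrow> real"
  where "F_potential f \<rho> c x y j =
    f (x j) (y j) + S_term \<rho> c y j
    - 15 / (2 * \<rho>) * (norm (y j - y (j - 1)))\<^sup>2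
    - c (j - 1) / 2 * (norm (y j))\<^sup>2"

end

theory Submission
  imports Defs
begin

text \<open>
  The standard cocoercivity estimate for a convex function with Lipschitz gradient steps outside
  \<open>Y\<close>, where nothing is assumed. Paired with a single direction \<open>w\<close> it reads
  \<open>\<langle>\<Delta>, w\<rangle> - (L/4) \<parallel>w\<parallel>\<^sup>2 \<le> \<langle>\<Delta>, q - p\<rangle>\<close>, where \<open>\<Delta>\<close> is the gradient difference between
  \<open>q\<close> and \<open>p\<close>. In this form it adds up over subdivisions of the segment \<open>[p, q]\<close>, so that the points
  evaluated off the segment may be taken arbitrarily close to it. Pushing \<open>p\<close> and \<open>q\<close>
  slightly towards a point of \<open>Y\<close> from which one can move along \<open>\<plusminus>w\<close> keeps these points in \<open>Y\<close>,
  and continuity of the gradient removes the push. The direction needed is the second difference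
  \<open>y\<^sub>k\<^sub>+\<^sub>1 - 2 y\<^sub>k + y\<^sub>k\<^sub>-\<^sub>1\<close>, for which the centroid of the three iterates is such a point.

  The optimality conditions of the projections that define \<open>y\<^sub>k\<close> and \<open>y\<^sub>k\<^sub>+\<^sub>1\<close> then bound both the
  increase of the regularized objective in \<open>y\<close> and the increase of \<open>\<parallel>y\<^sub>k\<^sub>+\<^sub>1 - y\<^sub>k\<parallel>\<^sup>2\<close>; the
  latter, scaled by \<open>16 / (\<rho> c\<^sub>k)\<close>, is absorbed by \<open>S_term\<close>.
\<close>

section \<open>Descent, tangent and cocoercivity inequalities inside a convex set\<close>

locale lipschitz_gradient_on =
  fixes S :: "'a::real_inner set" and \<phi> :: "'a \<Rightarrow> real" and g :: "'a \<Rightarrow> 'a" and L :: real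
  assumes convex_S: "convex S"
    and gradient: "u \<in> S \<Longrightarrow> (\<phi> has_derivative (\<lambda>h. g u \<bullet> h)) (at u within S)"
    and lipschitz: "u \<in> S \<Longrightarrow> v \<in> S \<Longrightarrow> norm (g u - g v) \<le> L * norm (u - v)"
begin

lemma segment_mem:
  assumes "p \<in> S" "q \<in> S" "0 \<le> t" "t \<le> (1::real)"
  shows "p + t *\<^sub>R (q - p) \<in> S"
  using convexD_alt[OF convex_S assms] by (simp add: algebra_simps)

lemma segment_derivative:
  assumes "p \<in> S" "q \<in> S" "0 \<le> t" "t \<le> (1::real)"
  shows "((\<lambda>t. \<phi> (p + t *\<^sub>R (q - p))) has_derivative (\<lambda>h. h * (g (p + t *\<^sub>R (q - p)) \<bullet> (q - p))))
    (at t within {0..1})"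
proof -
  have "((\<lambda>t. p + t *\<^sub>R (q - p)) has_derivative (\<lambda>h. h *\<^sub>R (q - p))) (at t within {0..1})"
    by (auto intro!: derivative_eq_intros)
  moreover have "(\<phi> has_derivative (\<lambda>h. g (p + t *\<^sub>R (q - p)) \<bullet> h))
      (at (p + t *\<^sub>R (q - p)) within (\<lambda>t. p + t *\<^sub>R (q - p)) ` {0..1})"
    by (rule has_derivative_subset[OF gradient]) (use segment_mem assms in auto)
  ultimately have "((\<lambda>t. \<phi> (p + t *\<^sub>R (q - p))) has_derivative
      (\<lambda>h. g (p + t *\<^sub>R (q - p)) \<bullet> (h *\<^sub>R (q - p)))) (at t within {0..1})"
    by (rule has_derivative_in_compose)
  then show ?thesis by simp
qed

text \<open>Once the tangent and the quadratic bound are subtracted along the segment, the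
  derivative of \<open>\<psi>\<close> is nonpositive by Cauchy-Schwarz and the Lipschitz bound; the
  mean value theorem then gives \<open>\<psi> 1 \<le> \<psi> 0\<close>.\<close>

lemma descent:
  assumes p: "p \<in> S" and q: "q \<in> S"
  shows "\<phi> q \<le> \<phi> p + g p \<bullet> (q - p) + L / 2 * (norm (q - p))\<^sup>2"
proof -
  define \<psi> where "\<psi> t = \<phi> (p + t *\<^sub>R (q - p)) - t * (g p \<bullet> (q - p)) - L / 2 * (norm (q - p))\<^sup>2 * t\<^sup>2"
    for t :: real
  have "(\<psi> has_derivative (\<lambda>h. h * ((g (p + t *\<^sub>R (q - p)) - g p) \<bullet> (q - p) - L * t * (norm (q - p))\<^sup>2)))
      (at t within {0..1})" if "0 \<le> t" "t \<le> 1" for t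
    unfolding \<psi>_def
    by (rule derivative_eq_intros segment_derivative[OF p q that] refl | simp)+
       (auto simp: fun_eq_iff algebra_simps inner_diff_left power2_eq_square)
  from mvt_very_simple[of 0 1 \<psi>, OF _ this]
  obtain t where t: "0 \<le> t" "t \<le> 1"
    and eq: "\<psi> 1 - \<psi> 0 = (g (p + t *\<^sub>R (q - p)) - g p) \<bullet> (q - p) - L * t * (norm (q - p))\<^sup>2"
    by force
  have "(g (p + t *\<^sub>R (q - p)) - g p) \<bullet> (q - p) \<le> norm (g (p + t *\<^sub>R (q - p)) - g p) * norm (q - p)"
    by (rule norm_cauchy_schwarz)
  also have "\<dots> \<le> (L * norm (p + t *\<^sub>R (q - p) - p)) * norm (q - p)"
    using lipschitz[OF segment_mem[OF p q t] p] by (rule mult_right_mono) simp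
  also have "\<dots> = L * t * (norm (q - p))\<^sup>2"
    using t by (simp add: power2_eq_square)
  finally show ?thesis
    using eq by (simp add: \<psi>_def)
qed

text \<open>Convexity bounds every difference quotient at \<open>p\<close> along the segment by
  \<open>\<phi> q - \<phi> p\<close>. The quotients tend to the one-sided derivative at 0, which
  exists even when \<open>p\<close> lies on the boundary of \<open>S\<close>.\<close>

lemma convex_above_tangent:
  assumes cvx: "convex_on S \<phi>" and p: "p \<in> S" and q: "q \<in> S"
  shows "\<phi> p + g p \<bullet> (q - p) \<le> \<phi> q"
proof -
  have "((\<lambda>t. \<phi> (p + t *\<^sub>R (q - p))) has_field_derivative g p \<bullet> (q - p)) (at 0 within {0..1})"
    using segment_derivative[OF p q, of 0] by (simp add: has_field_derivative_def mult_commute_abs)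
  then have lim: "((\<lambda>t. (\<phi> (p + t *\<^sub>R (q - p)) - \<phi> p) / t) \<longlongrightarrow> g p \<bullet> (q - p)) (at 0 within {0..1})"
    by (simp add: has_field_derivative_iff)
  have "\<forall>\<^sub>F t in at 0 within {0..1}. (\<phi> (p + t *\<^sub>R (q - p)) - \<phi> p) / t \<le> \<phi> q - \<phi> p"
    unfolding eventually_at_topological
  proof (intro exI[of _ UNIV] conjI ballI impI)
    fix t :: real
    assume "t \<noteq> 0" "t \<in> {0..1}"
    then have t: "0 < t" "t \<le> 1" by auto
    have "\<phi> ((1 - t) *\<^sub>R p + t *\<^sub>R q) \<le> (1 - t) * \<phi> p + t * \<phi> q"
      using convex_onD[OF cvx _ _ p q] t by simp
    moreover have "(1 - t) *\<^sub>R p + t *\<^sub>R q = p + t *\<^sub>R (q - p)"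
      by (simp add: algebra_simps)
    ultimately have "\<phi> (p + t *\<^sub>R (q - p)) - \<phi> p \<le> t * (\<phi> q - \<phi> p)"
      by (simp add: algebra_simps)
    then show "(\<phi> (p + t *\<^sub>R (q - p)) - \<phi> p) / t \<le> \<phi> q - \<phi> p"
      using t by (simp add: field_simps)
  qed auto
  moreover have "at 0 within {0..1::real} \<noteq> bot"
    by (simp add: trivial_limit_within islimpt_Icc)
  ultimately have "g p \<bullet> (q - p) \<le> \<phi> q - \<phi> p"
    by (rule tendsto_upperbound[OF lim])
  then show ?thesis by simp
qed

text \<open>At \<open>b - s\<close> the tangent at \<open>a\<close> bounds from below and the
  descent inequality at \<open>b\<close> from above; at \<open>a + s\<close> the roles are
  exchanged. Adding the four inequalities cancels all function values.\<close>

lemma cocoercive_local: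
  assumes cvx: "convex_on S \<phi>"
    and mem: "a \<in> S" "b \<in> S" "a + s \<in> S" "b - s \<in> S"
  shows "2 * ((g b - g a) \<bullet> s) - L * (norm s)\<^sup>2 \<le> (g b - g a) \<bullet> (b - a)"
proof -
  have "\<phi> a + g a \<bullet> (b - s - a) \<le> \<phi> (b - s)" "\<phi> b + g b \<bullet> (a + s - b) \<le> \<phi> (a + s)"
    using convex_above_tangent[OF cvx] mem by auto
  moreover have "\<phi> (b - s) \<le> \<phi> b - g b \<bullet> s + L / 2 * (norm s)\<^sup>2"
    "\<phi> (a + s) \<le> \<phi> a + g a \<bullet> s + L / 2 * (norm s)\<^sup>2"
    using descent[OF mem(2,4)] descent[OF mem(1,3)] by simp_all
  ultimately show ?thesis
    by (simp add: inner_diff_left inner_diff_right inner_add_right)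
qed

lemma cocoercive_segment:
  assumes cvx: "convex_on S \<phi>" and "\<epsilon> > 0"
    and p: "p \<in> S" "p + \<epsilon> *\<^sub>R w \<in> S" "p - \<epsilon> *\<^sub>R w \<in> S"
    and q: "q \<in> S" "q + \<epsilon> *\<^sub>R w \<in> S" "q - \<epsilon> *\<^sub>R w \<in> S"
  shows "(g q - g p) \<bullet> w - L / 4 * (norm w)\<^sup>2 \<le> (g q - g p) \<bullet> (q - p)"
proof -
  obtain n :: nat where n: "n > 0" "1 / real n < 2 * \<epsilon>"
    using reals_Archimedean[of "2 * \<epsilon>"] \<open>\<epsilon> > 0\<close> by (auto simp: inverse_eq_divide intro: that[of "Suc _"])
  define a where "a i = p + (real i / real n) *\<^sub>R (q - p)" for i
  have step: "a (Suc i) - a i = (1 / real n) *\<^sub>R (q - p)" for i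
    by (simp add: a_def add_divide_distrib algebra_simps)
  have ends: "a 0 = p" "a n = q"
    using n by (simp_all add: a_def)
  have a_mem: "a i \<in> S" "a i + (1 / (2 * real n)) *\<^sub>R w \<in> S" "a i - (1 / (2 * real n)) *\<^sub>R w \<in> S"
    if "i \<le> n" for i
  proof -
    have t: "0 \<le> real i / real n" "real i / real n \<le> 1" using that n by auto
    show a: "a i \<in> S" unfolding a_def by (rule segment_mem[OF p(1) q(1) t])
    \<comment> \<open>These lie on the segments joining the shifted copies of \<open>p\<close> and
      \<open>q\<close>. Shrinking towards \<open>a i\<close> by the factor
      \<open>1 / (2 * n * \<epsilon>)\<close>, at most 1 by the choice of \<open>n\<close>, gives
      the shorter shifts.\<close>
    have "a i + \<epsilon> *\<^sub>R w \<in> S" "a i - \<epsilon> *\<^sub>R w \<in> S"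
      using segment_mem[OF p(2) q(2) t] segment_mem[OF p(3) q(3) t]
      by (simp_all add: a_def algebra_simps)
    moreover have r: "0 \<le> 1 / (2 * real n * \<epsilon>)" "1 / (2 * real n * \<epsilon>) \<le> 1"
      using n \<open>\<epsilon> > 0\<close> by (auto simp: field_simps)
    ultimately show "a i + (1 / (2 * real n)) *\<^sub>R w \<in> S" "a i - (1 / (2 * real n)) *\<^sub>R w \<in> S"
      using segment_mem[OF a _ r] \<open>\<epsilon> > 0\<close> by fastforce+
  qed
  have "(g (a (Suc i)) - g (a i)) \<bullet> w - L / 4 * (norm w)\<^sup>2 / n \<le> (g (a (Suc i)) - g (a i)) \<bullet> (q - p)"
    if "i < n" for i
  proof -
    \<comment> \<open>The shift \<open>w / (2 * n)\<close> turns the factor 2 into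
      \<open>1 / n\<close>, matching the step \<open>(q - p) / n\<close>. The quadratic term is of
      order \<open>1 / n^2\<close>, so its sum over \<open>n\<close> pieces, after cancelling one
      \<open>1 / n\<close>, is exactly \<open>L / 4 * (norm w)^2\<close>.\<close>
    have "2 * ((g (a (Suc i)) - g (a i)) \<bullet> ((1 / (2 * real n)) *\<^sub>R w)) - L * (norm ((1 / (2 * real n)) *\<^sub>R w))\<^sup>2
        \<le> (g (a (Suc i)) - g (a i)) \<bullet> (a (Suc i) - a i)"
      using that by (intro cocoercive_local[OF cvx] a_mem) auto
    then have "((g (a (Suc i)) - g (a i)) \<bullet> w - L / 4 * (norm w)\<^sup>2 / n) / n
        \<le> (g (a (Suc i)) - g (a i)) \<bullet> (q - p) / n"
      unfolding step inner_scaleR_right norm_scaleR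
      by (simp add: power2_eq_square diff_divide_distrib mult.commute mult.left_commute)
    then show ?thesis
      using n by (simp add: divide_le_cancel)
  qed
  then have "(\<Sum>i<n. (g (a (Suc i)) - g (a i)) \<bullet> w - L / 4 * (norm w)\<^sup>2 / n)
      \<le> (\<Sum>i<n. (g (a (Suc i)) - g (a i)) \<bullet> (q - p))"
    by (intro sum_mono) auto
  moreover have "(\<Sum>i<n. (g (a (Suc i)) - g (a i)) \<bullet> z) = (g q - g p) \<bullet> z" for z
    using sum_lessThan_telescope[of "\<lambda>i. g (a i)" n] by (simp add: ends flip: inner_sum_left)
  ultimately show ?thesis
    using n by (simp add: sum_subtractf)
qed

lemma cocoercive_direction:
  assumes cvx: "convex_on S \<phi>" and "\<epsilon> > 0" and p: "p \<in> S" and q: "q \<in> S"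
    and m: "m \<in> S" "m + \<epsilon> *\<^sub>R w \<in> S" "m - \<epsilon> *\<^sub>R w \<in> S"
  shows "(g q - g p) \<bullet> w - L / 4 * (norm w)\<^sup>2 \<le> (g q - g p) \<bullet> (q - p)"
proof -
  define t where "t n = inverse (real (Suc n))" for n
  have t: "0 < t n" "t n \<le> 1" for n
    by (auto simp: t_def inverse_le_1_iff)
  have t_lim: "t \<longlonglongrightarrow> 0"
    unfolding t_def by (rule LIMSEQ_inverse_real_of_nat)
  define push where "push u n = u + t n *\<^sub>R (m - u)" for u n
  \<comment> \<open>Pushing \<open>u\<close> towards \<open>m + \<epsilon> w\<close> or
    \<open>m - \<epsilon> w\<close> instead of \<open>m\<close> moves the result by
    \<open>t n * \<epsilon>\<close> along \<open>w\<close> or \<open>- w\<close>.\<close>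
  have push_mem: "push u n \<in> S" "push u n + (t n * \<epsilon>) *\<^sub>R w \<in> S" "push u n - (t n * \<epsilon>) *\<^sub>R w \<in> S"
    if "u \<in> S" for u n
    using segment_mem[OF that m(1), of "t n"] segment_mem[OF that m(2), of "t n"]
      segment_mem[OF that m(3), of "t n"] t[of n]
    by (simp_all add: push_def algebra_simps)
  have push_lim: "push u \<longlonglongrightarrow> u" for u
    unfolding push_def by (rule tendsto_eq_intros t_lim refl | simp)+
  have g_lim: "(\<lambda>n. g (push u n)) \<longlonglongrightarrow> g u" if "u \<in> S" for u
  proof (rule LIM_zero_cancel, rule Lim_null_comparison)
    show "\<forall>\<^sub>F n in sequentially. norm (g (push u n) - g u) \<le> L * norm (push u n - u)"
      using lipschitz push_mem(1) that by auto
    show "(\<lambda>n. L * norm (push u n - u)) \<longlonglongrightarrow> 0"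
      using tendsto_mult_right_zero[OF tendsto_norm_zero[OF LIM_zero[OF push_lim]]] .
  qed
  have "(g (push q n) - g (push p n)) \<bullet> w - L / 4 * (norm w)\<^sup>2
      \<le> (g (push q n) - g (push p n)) \<bullet> (push q n - push p n)" for n
    using push_mem[OF p] push_mem[OF q] t \<open>\<epsilon> > 0\<close>
    by (intro cocoercive_segment[OF cvx, of "t n * \<epsilon>"]) auto
  moreover have "(\<lambda>n. (g (push q n) - g (push p n)) \<bullet> w - L / 4 * (norm w)\<^sup>2)
      \<longlonglongrightarrow> (g q - g p) \<bullet> w - L / 4 * (norm w)\<^sup>2"
    by (intro tendsto_intros g_lim p q)
  moreover have "(\<lambda>n. (g (push q n) - g (push p n)) \<bullet> (push q n - push p n))
      \<longlonglongrightarrow> (g q - g p) \<bullet> (q - p)"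
    by (intro tendsto_intros g_lim push_lim p q)
  ultimately show ?thesis
    using LIMSEQ_le by blast
qed

text \<open>With \<open>w = (q - p) - (r - q)\<close> the term \<open>q - p\<close> cancels on both
  sides of \<open>cocoercive_direction\<close>, leaving only the pairing with
  \<open>r - q\<close>.\<close>

lemma cocoercive_second_difference:
  assumes cvx: "convex_on S \<phi>" and mem: "p \<in> S" "q \<in> S" "r \<in> S"
  shows "- ((g q - g p) \<bullet> (r - q)) - L / 4 * (norm (r - q - (q - p)))\<^sup>2 \<le> 0"
proof -
  define w where "w = - (r - q - (q - p))"
  define m where "m = (1/3::real) *\<^sub>R p + (1/3::real) *\<^sub>R q + (1/3::real) *\<^sub>R r"
  have comb: "\<alpha> *\<^sub>R p + \<beta> *\<^sub>R q + \<gamma> *\<^sub>R r \<in> S"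
    if "0 \<le> \<alpha>" "0 \<le> \<beta>" "0 \<le> \<gamma>" "\<alpha> + \<beta> + \<gamma> = 1" for \<alpha> \<beta> \<gamma> :: real
  proof -
    have "\<alpha> *\<^sub>R p + \<beta> *\<^sub>R q + \<gamma> *\<^sub>R r \<in> convex hull {p, q, r}"
      unfolding convex_hull_3 using that by blast
    moreover have "convex hull {p, q, r} \<subseteq> S"
      using mem convex_S by (simp add: subset_hull)
    ultimately show ?thesis by blast
  qed
  have sixths: "(1/3::real) *\<^sub>R z = (1/6::real) *\<^sub>R z + (1/6::real) *\<^sub>R z"
    "(2/3::real) *\<^sub>R z = (1/3::real) *\<^sub>R z + (1/3::real) *\<^sub>R z"
    "(1/2::real) *\<^sub>R z = (1/3::real) *\<^sub>R z + (1/6::real) *\<^sub>R z" for z :: 'a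
    by (simp_all flip: scaleR_add_left)
  \<comment> \<open>The length 1/6 keeps all weights nonnegative and is the largest that does: at
    \<open>m - w / 6\<close>, the midpoint of \<open>p\<close> and \<open>r\<close>, the weight of
    \<open>q\<close> has dropped to 0.\<close>
  have "m + (1/6::real) *\<^sub>R w = (1/6::real) *\<^sub>R p + (2/3::real) *\<^sub>R q + (1/6::real) *\<^sub>R r"
    "m - (1/6::real) *\<^sub>R w = (1/2::real) *\<^sub>R p + 0 *\<^sub>R q + (1/2::real) *\<^sub>R r"
    by (simp_all add: m_def w_def sixths scaleR_diff_right)
  then have "m \<in> S" "m + (1/6::real) *\<^sub>R w \<in> S" "m - (1/6::real) *\<^sub>R w \<in> S"
    using comb[of "1/3" "1/3" "1/3"] comb[of "1/6" "2/3" "1/6"] comb[of "1/2" 0 "1/2"]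
    by (auto simp: m_def)
  then have "(g q - g p) \<bullet> w - L / 4 * (norm w)\<^sup>2 \<le> (g q - g p) \<bullet> (q - p)"
    by (intro cocoercive_direction[OF cvx, of "1/6"] mem) auto
  then show ?thesis
    unfolding w_def by (simp add: inner_diff_right norm_minus_commute)
qed

end


section \<open>Slices of the objective in one block of variables\<close>

lemma smooth_with_gradients_imp_lipschitz_gradient_x:
  assumes "convex X" "smooth_with_gradients X Y f gx gy"
    and "lipschitz_gradients X Y gx gy L11 L12 L21 L22" "v \<in> Y"
  shows "lipschitz_gradient_on X (\<lambda>u. f u v) (\<lambda>u. gx u v) L11"
proof
  fix u assume u: "u \<in> X"
  have pair: "((\<lambda>u. (u, v)) has_derivative (\<lambda>h. (h, 0))) (at u within X)"
    by (auto intro!: derivative_eq_intros)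
  have "((\<lambda>(u, v). f u v) has_derivative (\<lambda>(h, k). gx u v \<bullet> h + gy u v \<bullet> k))
      (at (u, v) within (\<lambda>u. (u, v)) ` X)"
    by (rule has_derivative_subset[where s = "X \<times> Y"])
      (use assms u in \<open>auto simp: smooth_with_gradients_def\<close>)
  from has_derivative_in_compose[OF pair this]
  show "((\<lambda>u. f u v) has_derivative (\<lambda>h. gx u v \<bullet> h)) (at u within X)"
    by simp
qed (use assms in \<open>auto simp: lipschitz_gradients_def\<close>)

text \<open>The sign is reversed because \<open>f\<close> is concave in \<open>y\<close>, whereas
  the inequalities above are for convex functions.\<close>

lemma smooth_with_gradients_imp_lipschitz_gradient_y:
  assumes "convex Y" "smooth_with_gradients X Y f gx gy"
    and "lipschitz_gradients X Y gx gy L11 L12 L21 L22" "u \<in> X"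
  shows "lipschitz_gradient_on Y (\<lambda>v. - f u v) (\<lambda>v. - gy u v) L22"
proof
  fix v assume v: "v \<in> Y"
  have pair: "((\<lambda>v. (u, v)) has_derivative (\<lambda>k. (0, k))) (at v within Y)"
    by (auto intro!: derivative_eq_intros)
  have "((\<lambda>(u, v). f u v) has_derivative (\<lambda>(h, k). gx u v \<bullet> h + gy u v \<bullet> k))
      (at (u, v) within (\<lambda>v. (u, v)) ` Y)"
    by (rule has_derivative_subset[where s = "X \<times> Y"])
      (use assms v in \<open>auto simp: smooth_with_gradients_def\<close>)
  from has_derivative_in_compose[OF pair this]
  show "((\<lambda>v. - f u v) has_derivative (\<lambda>k. - gy u v \<bullet> k)) (at v within Y)"
    using has_derivative_minus by fastforce
next
  fix v v' assume "v \<in> Y" "v' \<in> Y"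
  then have "norm (gy u v - gy u v') \<le> L22 * norm (v - v')"
    using assms by (auto simp: lipschitz_gradients_def)
  then show "norm (- gy u v - - gy u v') \<le> L22 * norm (v - v')"
    by (simp add: norm_minus_commute)
qed (use assms in auto)

lemma scaled_AM_GM:
  fixes a b t :: real
  assumes "t > 0"
  shows "a * b \<le> a\<^sup>2 / (2 * t) + t / 2 * b\<^sup>2"
proof -
  have "0 \<le> (a - t * b)\<^sup>2 / (2 * t)"
    using assms by simp
  also have "\<dots> = a\<^sup>2 / (2 * t) + t / 2 * b\<^sup>2 - a * b"
    using assms by (simp add: power2_eq_square field_simps)
  finally show ?thesis by simp
qed

section \<open>Decrease of the potential\<close>

theorem lemma3p4:
  fixes X :: "(real ^ 'n) set" and Y :: "(real ^ 'm) set"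
    and f :: "real ^ 'n \<Rightarrow> real ^ 'm \<Rightarrow> real"
    and grad_x :: "real ^ 'n \<Rightarrow> real ^ 'm \<Rightarrow> real ^ 'n"
    and grad_y :: "real ^ 'n \<Rightarrow> real ^ 'm \<Rightarrow> real ^ 'm"
    and L11 L12 L21 L22 L22' \<eta> \<rho> :: real
    and c \<beta> :: "nat \<Rightarrow> real"
    and x :: "nat \<Rightarrow> real ^ 'n" and y :: "nat \<Rightarrow> real ^ 'm"
  assumes X: "X \<noteq> {}" "closed X" "bounded X" "convex X"
    and Y: "Y \<noteq> {}" "closed Y" "bounded Y" "convex Y"
    and smooth: "smooth_with_gradients X Y f grad_x grad_y"
    and concave: "\<And>u. u \<in> X \<Longrightarrow> concave_on Y (f u)"
    and L_pos: "L11 > 0" "L12 > 0" "L21 > 0" "L22 > 0"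
    and lipschitz: "lipschitz_gradients X Y grad_x grad_y L11 L12 L21 L22"
    and c_pos: "\<And>k. k \<ge> 1 \<Longrightarrow> c k > 0"
    and c_decreasing: "antimono_on {1..} c"
    and eta_pos: "\<eta> > 0" and rho_pos: "\<rho> > 0"
    and init: "x 1 \<in> X" "y 1 \<in> Y"
    and x_step: "\<And>k. k \<ge> 1 \<Longrightarrow>
      x (k + 1) = closest_point X (x k - (1 / (\<eta> + \<beta> k)) *\<^sub>R grad_x (x k) (y k))"
    and y_step: "\<And>k. k \<ge> 1 \<Longrightarrow>
      y (k + 1) = closest_point Y (y k + \<rho> *\<^sub>R grad_y (x (k + 1)) (y k) - (\<rho> * c k) *\<^sub>R y k)"
    and L22': "L22' = L22 + c 1"
    and beta_large: "\<And>k. k \<ge> 1 \<Longrightarrow> \<beta> k > L11"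
    and c_slow: "\<And>k. k \<ge> 1 \<Longrightarrow> 1 / c (k + 1) - 1 / c k \<le> \<rho> / 5"
    and rho_small: "\<rho> \<le> 2 / (L22' + c 1)"
  shows "\<forall>k\<ge>2.
    F_potential f \<rho> c x y (k + 1) - F_potential f \<rho> c x y k \<le>
      - (\<eta> + \<beta> k / 2 - \<rho> * L12\<^sup>2 / 2 - 16 * L12\<^sup>2 / (\<rho> * (c k)\<^sup>2)) * (norm (x (k + 1) - x k))\<^sup>2
      + (c (k - 1) - c k) / 2 * (norm (y (k + 1)))\<^sup>2
      - 9 / (10 * \<rho>) * (norm (y (k + 1) - y k))\<^sup>2
      + 8 / \<rho> * (c (k - 1) / c k - c k / c (k + 1)) * (norm (y (k + 1)))\<^sup>2"
proof (intro allI impI)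
  fix k :: nat
  assume k: "2 \<le> k"
  have x_mem: "x i \<in> X" if "i \<ge> 1" for i
    using that
  proof (induction i rule: dec_induct)
    case (step i)
    then show ?case using x_step[of i] closest_point_in_set[OF X(2,1)] by simp
  qed (use init in simp)
  have y_mem: "y i \<in> Y" if "i \<ge> 1" for i
    using that
  proof (induction i rule: dec_induct)
    case (step i)
    then show ?case using y_step[of i] closest_point_in_set[OF Y(2,1)] by simp
  qed (use init in simp)
  define dx where "dx = x (k + 1) - x k"
  define s where "s = y (k + 1) - y k"
  define d where "d = y k - y (k - 1)"
  define H where "H = (grad_y (x (k + 1)) (y k) - grad_y (x k) (y k)) \<bullet> s"
  define A where "A = (norm dx)\<^sup>2"
  define B where "B = (norm s)\<^sup>2"
  define D where "D = (norm d)\<^sup>2"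
  define V where "V = (norm (s - d))\<^sup>2"
  define E where "E = (norm (y (k + 1)))\<^sup>2"
  define E' where "E' = (norm (y k))\<^sup>2"
  have c: "0 < c k" "0 < c (k + 1)" "c (k + 1) \<le> c k" "c k \<le> c (k - 1)" "c (k - 1) \<le> c 1"
    using c_pos c_decreasing k by (auto simp: monotone_on_def)
  have mem: "x k \<in> X" "x (k + 1) \<in> X" "y (k - 1) \<in> Y" "y k \<in> Y" "y (k + 1) \<in> Y"
    using k by (auto intro!: x_mem y_mem)
  have nonneg: "A \<ge> 0" "B \<ge> 0" "D \<ge> 0" "V \<ge> 0" "E \<ge> 0" "E' \<ge> 0"
    by (simp_all add: A_def B_def D_def V_def E_def E'_def)
  \<comment> \<open>Such identities trade inner products for squared norms, so that the estimates
    below combine linearly.\<close>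
  have V: "V = B + D - 2 * (d \<bullet> s)"
    by (simp add: V_def B_def D_def power2_norm_eq_inner inner_diff_left inner_diff_right inner_commute)
  have ys: "y k \<bullet> s = (E - E' - B) / 2"
    by (simp add: s_def E_def E'_def B_def power2_norm_eq_inner inner_diff_left inner_diff_right inner_commute)
  have ys': "y (k - 1) \<bullet> s = y k \<bullet> s - d \<bullet> s"
    by (simp add: d_def inner_diff_left)

  \<comment> \<open>The projection inequality tested at \<open>x k\<close> contributes
    \<open>- (\<eta> + \<beta> k) * A\<close>; the descent lemma gives back at most
    \<open>\<beta> k / 2 * A\<close>, since \<open>L11 < \<beta> k\<close>.\<close>
  have x_descent: "f (x (k + 1)) (y k) - f (x k) (y k) \<le> - (\<eta> + \<beta> k / 2) * A"
  proof -
    have \<beta>: "\<beta> k > L11" using beta_large k by simp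
    interpret lipschitz_gradient_on X "\<lambda>u. f u (y k)" "\<lambda>u. grad_x u (y k)" L11
      by (rule smooth_with_gradients_imp_lipschitz_gradient_x[OF X(4) smooth lipschitz mem(4)])
    have pos: "\<eta> + \<beta> k > 0" using \<beta> L_pos eta_pos by linarith
    have "(x k - (1 / (\<eta> + \<beta> k)) *\<^sub>R grad_x (x k) (y k) - x (k + 1)) \<bullet> (x k - x (k + 1)) \<le> 0"
      using closest_point_dot[OF X(4,2) mem(1)] x_step[of k] k by simp
    moreover have "x k - (1 / (\<eta> + \<beta> k)) *\<^sub>R grad_x (x k) (y k) - x (k + 1)
        = - ((1 / (\<eta> + \<beta> k)) *\<^sub>R grad_x (x k) (y k)) - dx" "x k - x (k + 1) = - dx"
      by (simp_all add: dx_def)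
    ultimately have "(- ((1 / (\<eta> + \<beta> k)) *\<^sub>R grad_x (x k) (y k)) - dx) \<bullet> (- dx) \<le> 0"
      by (simp only:)
    then have "(1 / (\<eta> + \<beta> k)) * (grad_x (x k) (y k) \<bullet> dx) \<le> - A"
      by (simp add: A_def power2_norm_eq_inner inner_diff_left)
    then have "grad_x (x k) (y k) \<bullet> dx \<le> - (\<eta> + \<beta> k) * A"
      using pos by (simp add: field_simps)
    moreover have "f (x (k + 1)) (y k) \<le> f (x k) (y k) + grad_x (x k) (y k) \<bullet> dx + L11 / 2 * A"
      using descent[OF mem(1,2)] by (simp add: dx_def A_def)
    moreover have "L11 * A \<le> \<beta> k * A"
      using \<beta> nonneg by (intro mult_right_mono) auto
    ultimately show ?thesis by (simp add: algebra_simps)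
  qed

  have y_concave: "f (x (k + 1)) (y (k + 1)) - f (x (k + 1)) (y k) \<le> grad_y (x (k + 1)) (y k) \<bullet> s"
  proof -
    interpret lipschitz_gradient_on Y "\<lambda>v. - f (x (k + 1)) v" "\<lambda>v. - grad_y (x (k + 1)) v" L22
      by (rule smooth_with_gradients_imp_lipschitz_gradient_y[OF Y(4) smooth lipschitz mem(2)])
    have "convex_on Y (\<lambda>v. - f (x (k + 1)) v)"
      using concave[OF mem(2)] by (simp add: concave_on_def)
    from convex_above_tangent[OF this mem(4,5)] show ?thesis
      by (simp add: s_def)
  qed

  have y_cocoercive: "(grad_y (x k) (y k) - grad_y (x k) (y (k - 1))) \<bullet> s \<le> L22 / 4 * V"
  proof -
    interpret lipschitz_gradient_on Y "\<lambda>v. - f (x k) v" "\<lambda>v. - grad_y (x k) v" L22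
      by (rule smooth_with_gradients_imp_lipschitz_gradient_y[OF Y(4) smooth lipschitz mem(1)])
    have "convex_on Y (\<lambda>v. - f (x k) v)"
      using concave[OF mem(1)] by (simp add: concave_on_def)
    from cocoercive_second_difference[OF this mem(3,4,5)] show ?thesis
      by (simp add: s_def d_def V_def inner_diff_left)
  qed

  have opt: "B \<le> \<rho> * (grad_y (x (k + 1)) (y k) \<bullet> s - c k * (y k \<bullet> s))"
  proof -
    have "(y k + \<rho> *\<^sub>R grad_y (x (k + 1)) (y k) - (\<rho> * c k) *\<^sub>R y k - y (k + 1)) \<bullet> (y k - y (k + 1)) \<le> 0"
      using closest_point_dot[OF Y(4,2) mem(4)] y_step[of k] k by simp
    moreover have "y k + \<rho> *\<^sub>R grad_y (x (k + 1)) (y k) - (\<rho> * c k) *\<^sub>R y k - y (k + 1)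
        = \<rho> *\<^sub>R grad_y (x (k + 1)) (y k) - (\<rho> * c k) *\<^sub>R y k - s" "y k - y (k + 1) = - s"
      by (simp_all add: s_def)
    ultimately have "(\<rho> *\<^sub>R grad_y (x (k + 1)) (y k) - (\<rho> * c k) *\<^sub>R y k - s) \<bullet> (- s) \<le> 0"
      by (simp only:)
    then show ?thesis
      by (simp add: B_def power2_norm_eq_inner inner_diff_left algebra_simps)
  qed

  \<comment> \<open>This is the projection defining \<open>y k\<close>, tested at the later iterate
    \<open>y (k + 1)\<close>; \<open>k \<ge> 2\<close> makes \<open>k - 1\<close> a valid
    step.\<close>
  have opt_prev: "\<rho> * (grad_y (x k) (y (k - 1)) \<bullet> s - c (k - 1) * (y (k - 1) \<bullet> s)) \<le> d \<bullet> s"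
  proof -
    have "(y (k - 1) + \<rho> *\<^sub>R grad_y (x k) (y (k - 1)) - (\<rho> * c (k - 1)) *\<^sub>R y (k - 1) - y k) \<bullet> s \<le> 0"
      using closest_point_dot[OF Y(4,2) mem(5)] y_step[of "k - 1"] k by (simp add: s_def)
    then show ?thesis
      by (simp add: d_def inner_diff_left inner_add_left algebra_simps)
  qed

  have H: "H \<le> (L12 * norm dx) * norm s"
  proof -
    have "norm (grad_y (x (k + 1)) (y k) - grad_y (x k) (y k)) \<le> L12 * norm dx"
      using lipschitz mem unfolding lipschitz_gradients_def dx_def by blast
    then show ?thesis
      unfolding H_def by (intro order_trans[OF norm_cauchy_schwarz] mult_right_mono) auto
  qed
  \<comment> \<open>The cross term \<open>H\<close> is split with two weights: \<open>H1\<close>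
    serves the growth of the objective; \<open>H2\<close>, with only \<open>c k / 4\<close> on
    \<open>B\<close>, serves the bound on \<open>B - D\<close>, which is later multiplied by
    \<open>16 / (\<rho> * c k)\<close>.\<close>
  have H1: "H \<le> \<rho> * L12\<^sup>2 / 2 * A + B / (2 * \<rho>)"
    using H scaled_AM_GM[of "1 / \<rho>" "L12 * norm dx" "norm s"] rho_pos
    by (simp add: A_def B_def power_mult_distrib mult_ac)
  have H2: "H \<le> L12\<^sup>2 / c k * A + c k / 4 * B"
    using H scaled_AM_GM[of "c k / 2" "L12 * norm dx" "norm s"] c
    by (simp add: A_def B_def power_mult_distrib mult_ac)

  have "L22' + c 1 > 0"
    using L22' L_pos c_pos[of 1] by simp
  \<comment> \<open>Here \<open>L22' + c 1 = L22 + 2 * c 1\<close>, so this is the step size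
    condition itself.\<close>
  then have "L22 / 4 + c 1 / 2 \<le> 1 / (2 * \<rho>)"
    using rho_small rho_pos L22' by (simp add: field_simps)
  then have "L22 / 4 + c (k - 1) / 2 \<le> 1 / (2 * \<rho>)"
    using c by simp
  then have "(L22 / 4 + c (k - 1) / 2) * V \<le> 1 / (2 * \<rho>) * V"
    using nonneg by (intro mult_right_mono)
  then have V_bound: "L22 / 4 * V \<le> V / (2 * \<rho>) - c (k - 1) / 2 * V"
    by (simp add: algebra_simps)

  have prev: "grad_y (x k) (y (k - 1)) \<bullet> s - c (k - 1) * (y (k - 1) \<bullet> s) \<le> (d \<bullet> s) / \<rho>"
    using opt_prev rho_pos by (simp add: field_simps)
  have cur: "B / \<rho> \<le> grad_y (x (k + 1)) (y k) \<bullet> s - c k * (y k \<bullet> s)"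
    using opt rho_pos by (simp add: field_simps)
  have ds: "d \<bullet> s = (B + D - V) / 2"
    using V by simp
  \<comment> \<open>The gradient is telescoped through \<open>(x k, y k)\<close> down to
    \<open>(x k, y (k - 1))\<close>. The \<open>V\<close> terms of \<open>V_bound\<close> then
    cancel against those hidden in \<open>d \<bullet> s\<close>.\<close>
  have split_grad: "grad_y (x (k + 1)) (y k) \<bullet> s - c (k - 1) * (y k \<bullet> s)
      \<le> H + (B + D) / (2 * \<rho>) - c (k - 1) / 2 * (B + D)"
  proof -
    have "grad_y (x (k + 1)) (y k) \<bullet> s
        \<le> H + V / (2 * \<rho>) - c (k - 1) / 2 * V + (d \<bullet> s) / \<rho> + c (k - 1) * (y k \<bullet> s - d \<bullet> s)"
      using y_cocoercive prev V_bound unfolding H_def ys' inner_diff_left by linarith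
    moreover have "V / (2 * \<rho>) + (d \<bullet> s) / \<rho> = (B + D) / (2 * \<rho>)"
      unfolding ds by (simp add: diff_divide_distrib)
    moreover have "c (k - 1) * (y k \<bullet> s - d \<bullet> s)
        = c (k - 1) * (y k \<bullet> s) - c (k - 1) / 2 * (B + D) + c (k - 1) / 2 * V"
      unfolding ds by (simp add: algebra_simps add_divide_distrib diff_divide_distrib)
    ultimately show ?thesis by linarith
  qed

  \<comment> \<open>Growth of the regularized objective and of the squared increments in
    \<open>y\<close>\<close>
  have ascent: "f (x (k + 1)) (y (k + 1)) - f (x (k + 1)) (y k) - c (k - 1) / 2 * (E - E')
      \<le> \<rho> * L12\<^sup>2 / 2 * A + B / \<rho> + D / (2 * \<rho>)"
  proof -
    have "c (k - 1) * (y k \<bullet> s) - c (k - 1) / 2 * (B + D)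
        = c (k - 1) / 2 * (E - E') - c (k - 1) * B - c (k - 1) / 2 * D"
      unfolding ys by (simp add: algebra_simps add_divide_distrib diff_divide_distrib)
    moreover have "0 \<le> c (k - 1) * B" "0 \<le> c (k - 1) / 2 * D"
      using c nonneg by auto
    moreover have "(B + D) / (2 * \<rho>) + B / (2 * \<rho>) = B / \<rho> + D / (2 * \<rho>)"
      by (simp add: add_divide_distrib)
    ultimately show ?thesis
      using y_concave split_grad H1 by linarith
  qed

  \<comment> \<open>\<open>cur\<close> bounds from below what \<open>split_grad\<close> bounds from
    above, except that the regularization weights are \<open>c k\<close> and
    \<open>c (k - 1)\<close>; the mismatch produces the term in \<open>E - E'\<close>.\<close>
  have contraction: "(B - D) / (2 * \<rho>) \<le>
      L12\<^sup>2 / c k * A + c k / 4 * B - c k / 2 * D + (c (k - 1) - c k) / 2 * (E - E')"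
  proof -
    have "c (k - 1) * (y k \<bullet> s) - c k * (y k \<bullet> s) - c (k - 1) / 2 * (B + D)
        = (c (k - 1) - c k) / 2 * (E - E') - c (k - 1) / 2 * D - (2 * c (k - 1) - c k) / 2 * B"
      unfolding ys by (simp add: algebra_simps add_divide_distrib diff_divide_distrib)
    moreover have "0 \<le> (2 * c (k - 1) - c k) / 2 * B" "c k / 2 * D \<le> c (k - 1) / 2 * D"
      using c nonneg by (auto intro!: mult_right_mono mult_nonneg_nonneg)
    moreover have "(B - D) / (2 * \<rho>) + (B + D) / (2 * \<rho>) = B / \<rho>"
      by (simp add: add_divide_distrib diff_divide_distrib)
    ultimately show ?thesis
      using cur split_grad H2 by linarith
  qed

  have S_diff: "S_term \<rho> c y (k + 1) - S_term \<rho> c y k \<le>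
      16 * L12\<^sup>2 / (\<rho> * (c k)\<^sup>2) * A + 28 / (5 * \<rho>) * B - 8 / \<rho> * D
      + 8 / \<rho> * (c (k - 1) / c k - c k / c (k + 1)) * E"
  proof -
    \<comment> \<open>The factor gives \<open>B - D\<close> the weight
      \<open>8 / (\<rho>^2 * c k)\<close> that \<open>S_term\<close> carries at
      \<open>k\<close>.\<close>
    have "16 / (\<rho> * c k) * ((B - D) / (2 * \<rho>)) \<le> 16 / (\<rho> * c k) *
        (L12\<^sup>2 / c k * A + c k / 4 * B - c k / 2 * D + (c (k - 1) - c k) / 2 * (E - E'))"
      using contraction c rho_pos by (intro mult_left_mono) auto
    also have "\<dots> = 16 * L12\<^sup>2 / (\<rho> * (c k)\<^sup>2) * A + 4 / \<rho> * B - 8 / \<rho> * D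
        + 8 / \<rho> * (c (k - 1) / c k - 1) * (E - E')"
      using c rho_pos by (simp add: field_simps power2_eq_square)
    finally have scaled: "8 / (\<rho>\<^sup>2 * c k) * B - 8 / (\<rho>\<^sup>2 * c k) * D \<le>
        16 * L12\<^sup>2 / (\<rho> * (c k)\<^sup>2) * A + 4 / \<rho> * B - 8 / \<rho> * D
        + 8 / \<rho> * (c (k - 1) / c k - 1) * (E - E')"
      by (simp add: power2_eq_square algebra_simps diff_divide_distrib)
    \<comment> \<open>At \<open>k + 1\<close> the weight of \<open>B\<close> in
      \<open>S_term\<close> involves \<open>c (k + 1)\<close>. The slow decay of \<open>c\<close>
      makes this change cost \<open>8 / (5 * \<rho>) * B\<close>.\<close>
    have "8 * B / \<rho>\<^sup>2 * (1 / c (k + 1) - 1 / c k) \<le> 8 * B / \<rho>\<^sup>2 * (\<rho> / 5)"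
      using c_slow[of k] k nonneg by (intro mult_left_mono) auto
    also have "\<dots> = 8 / (5 * \<rho>) * B"
      using rho_pos by (simp add: field_simps power2_eq_square)
    finally have "8 / (\<rho>\<^sup>2 * c (k + 1)) * B - 8 / (\<rho>\<^sup>2 * c k) * B \<le> 8 / (5 * \<rho>) * B"
      by (simp add: algebra_simps diff_divide_distrib)
    moreover have "S_term \<rho> c y (k + 1) - S_term \<rho> c y k =
        8 / (\<rho>\<^sup>2 * c (k + 1)) * B + 8 / \<rho> * (1 - c k / c (k + 1)) * E
        - 8 / (\<rho>\<^sup>2 * c k) * D - 8 / \<rho> * (1 - c (k - 1) / c k) * E'"
      by (simp add: S_term_def B_def D_def E_def E'_def s_def d_def)
    moreover have "28 / (5 * \<rho>) * B = 4 / \<rho> * B + 8 / (5 * \<rho>) * B"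
      using rho_pos by (simp add: field_simps)
    \<comment> \<open>The second summand of \<open>S_term\<close> is built so that \<open>E'\<close>
      drops out here.\<close>
    moreover have "8 / \<rho> * (c (k - 1) / c k - 1) * (E - E') + 8 / \<rho> * (1 - c k / c (k + 1)) * E
        - 8 / \<rho> * (1 - c (k - 1) / c k) * E' = 8 / \<rho> * (c (k - 1) / c k - c k / c (k + 1)) * E"
      by (simp add: algebra_simps diff_divide_distrib add_divide_distrib)
    ultimately show ?thesis
      using scaled by linarith
  qed

  \<comment> \<open>Assembly of the estimates\<close>
  have "F_potential f \<rho> c x y (k + 1) - F_potential f \<rho> c x y k =
      (f (x (k + 1)) (y k) - f (x k) (y k))
      + (f (x (k + 1)) (y (k + 1)) - f (x (k + 1)) (y k) - c (k - 1) / 2 * (E - E'))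
      + (S_term \<rho> c y (k + 1) - S_term \<rho> c y k)
      - 15 / (2 * \<rho>) * B + 15 / (2 * \<rho>) * D + (c (k - 1) - c k) / 2 * E"
    by (simp add: F_potential_def B_def D_def E_def E'_def s_def d_def algebra_simps diff_divide_distrib)
  also have "\<dots> \<le> - (\<eta> + \<beta> k / 2) * A + (\<rho> * L12\<^sup>2 / 2 * A + B / \<rho> + D / (2 * \<rho>))
      + (16 * L12\<^sup>2 / (\<rho> * (c k)\<^sup>2) * A + 28 / (5 * \<rho>) * B - 8 / \<rho> * D
        + 8 / \<rho> * (c (k - 1) / c k - c k / c (k + 1)) * E)
      - 15 / (2 * \<rho>) * B + 15 / (2 * \<rho>) * D + (c (k - 1) - c k) / 2 * E"
    using x_descent ascent S_diff by linarith
  also have "\<dots> = - (\<eta> + \<beta> k / 2 - \<rho> * L12\<^sup>2 / 2 - 16 * L12\<^sup>2 / (\<rho> * (c k)\<^sup>2)) * A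
      + (c (k - 1) - c k) / 2 * E - 9 / (10 * \<rho>) * B
      + 8 / \<rho> * (c (k - 1) / c k - c k / c (k + 1)) * E"
  proof -
    \<comment> \<open>The weight 15/2 in the potential is what cancels \<open>D\<close>, as 1/2 - 8
      + 15/2 = 0; for \<open>B\<close> it leaves 1 + 28/5 - 15/2 = -9/10.\<close>
    have "B / \<rho> + 28 / (5 * \<rho>) * B - 15 / (2 * \<rho>) * B = - 9 / (10 * \<rho>) * B"
      "D / (2 * \<rho>) - 8 / \<rho> * D + 15 / (2 * \<rho>) * D = 0"
      using rho_pos by (simp_all add: field_simps)
    then show ?thesis
      by (simp add: left_diff_distrib distrib_right)
  qed
  finally show "F_potential f \<rho> c x y (k + 1) - F_potential f \<rho> c x y k \<le>
      - (\<eta> + \<beta> k / 2 - \<rho> * L12\<^sup>2 / 2 - 16 * L12\<^sup>2 / (\<rho> * (c k)\<^sup>2)) * (norm (x (k + 1) - x k))\<^sup>2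
      + (c (k - 1) - c k) / 2 * (norm (y (k + 1)))\<^sup>2
      - 9 / (10 * \<rho>) * (norm (y (k + 1) - y k))\<^sup>2
      + 8 / \<rho> * (c (k - 1) / c k - c k / c (k + 1)) * (norm (y (k + 1)))\<^sup>2"
    by (simp only: A_def B_def E_def dx_def s_def)
qed

end
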